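(* Let $\kappa$ be a cardinal and assume $\mathsf{MA}_\kappa$. Let $X\subseteq\mathbb{R}$ be a set of cardinality $\kappa$, and let $\{A_x : x\in X\}$ be a real almost chain of subsets of $\omega$, i.e. $A_x\subseteq\omega$ for every $x\in X$ and $A_x\subseteq^* A_y$ whenever $x,y\in X$ and $x<y$. Then $\{A_x : x\in X\}$ has a barely alternating finite adjustment; that is, there is a family $\{B_x : x\in X\}$ of subsets of $\omega$ such that $B_x =^* A_x$ for all $x\in X$, and $B_{x_1}\cap B_{x_3}\subseteq B_{x_2}\cup B_{x_4}$ whenever $x_1<x_2<x_3<x_4$ are elements of $X$.
   Context: For sets $R,S$: $R\subseteq^* S$ means that $R\setminus S$ is finite, and $R=^*S$ means that $R\subseteq^* S$ and $S\subseteq^* R$. A real almost chain is a family of sets $\{A_x : x\in X\}$ indexed by a set $X\subseteq\mathbb{R}$ such that $A_x\subseteq^* A_y$ whenever $x<y$ in $X$. A family $\{B_x : x\in X\}$ is a finite adjustment of $\{A_x : x\in X\}$ if $A_x=^*B_x$ for all $x\in X$. A family $\{A_x : x\in X\}$ is barely alternating if $A_{x_1}\cap A_{x_3}\subseteq A_{x_2}\cup A_{x_4}$ whenever $x_1<x_2<x_3<x_4$ in $X$. Martin's Axiom $\mathsf{MA}_\kappa$ is the statement: for every nonempty partial order $\mathbb{P}$ satisfying the countable chain condition (every family of pairwise incompatible elements is countable) and every family $\mathcal{D}$ of at most $\kappa$ dense subsets of $\mathbb{P}$, there is a filter $G\subseteq\mathbb{P}$ with $G\cap D\neq\emptyset$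 for all $D\in\mathcal{D}$. *)

theory Defs
  imports Complex_Main "HOL-Library.Countable_Set"
begin

unbundle cardinal_syntax

definition almost_subset :: "'a set \<Rightarrow> 'a set \<Rightarrow> bool"  (infix "\<subseteq>*" 50)
  where "R \<subseteq>* S \<longleftrightarrow> finite (R - S)"

definition almost_eq :: "'a set \<Rightarrow> 'a set \<Rightarrow> bool"  (infix "=*" 50)
  where "R =* S \<longleftrightarrow> R \<subseteq>* S \<and> S \<subseteq>* R"

text \<open>A family indexed by a set \<open>X\<close> of reals is a function on all reals of which only the
  values on \<open>X\<close> matter.\<close>

definition real_almost_chain :: "real set \<Rightarrow> (real \<Rightarrow> 'a set) \<Rightarrow> bool"
  where "real_almost_chain X A \<longleftrightarrow> (\<forall>x\<in>X. \<forall>y\<in>X. x < y \<longrightarrow> A x \<subseteq>* A y)"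

definition finite_adjustment :: "real set \<Rightarrow> (real \<Rightarrow> 'a set) \<Rightarrow> (real \<Rightarrow> 'a set) \<Rightarrow> bool"
  where "finite_adjustment X A B \<longleftrightarrow> (\<forall>x\<in>X. A x =* B x)"

definition barely_alternating :: "real set \<Rightarrow> (real \<Rightarrow> 'a set) \<Rightarrow> bool"
  where "barely_alternating X B \<longleftrightarrow>
    (\<forall>x1\<in>X. \<forall>x2\<in>X. \<forall>x3\<in>X. \<forall>x4\<in>X. x1 < x2 \<and> x2 < x3 \<and> x3 < x4 \<longrightarrow>
       B x1 \<inter> B x3 \<subseteq> B x2 \<union> B x4)"

text \<open>A partial order is a set \<open>P\<close> with a relation \<open>r\<close>, where \<open>(p, q) \<in> r\<close> means
  \<open>p \<le> q\<close>, that is, \<open>p\<close> extends \<open>q\<close>.\<close>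

definition compatible_in :: "'p set \<Rightarrow> 'p rel \<Rightarrow> 'p \<Rightarrow> 'p \<Rightarrow> bool"
  where "compatible_in P r p q \<longleftrightarrow> (\<exists>s\<in>P. (s, p) \<in> r \<and> (s, q) \<in> r)"

definition ccc :: "'p set \<Rightarrow> 'p rel \<Rightarrow> bool"
  where "ccc P r \<longleftrightarrow>
    (\<forall>C\<subseteq>P. pairwise (\<lambda>p q. \<not> compatible_in P r p q) C \<longrightarrow> countable C)"

definition dense_subset :: "'p set \<Rightarrow> 'p rel \<Rightarrow> 'p set \<Rightarrow> bool"
  where "dense_subset P r D \<longleftrightarrow> D \<subseteq> P \<and> (\<forall>p\<in>P. \<exists>d\<in>D. (d, p) \<in> r)"

definition poset_filter :: "'p set \<Rightarrow> 'p rel \<Rightarrow> 'p set \<Rightarrow> bool"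
  where "poset_filter P r G \<longleftrightarrow> G \<subseteq> P \<and> G \<noteq> {} \<and>
    (\<forall>p\<in>G. \<forall>q\<in>P. (p, q) \<in> r \<longrightarrow> q \<in> G) \<and>
    (\<forall>p\<in>G. \<forall>q\<in>G. \<exists>s\<in>G. (s, p) \<in> r \<and> (s, q) \<in> r)"

text \<open>HOL cannot quantify over all types inside a proposition, so Martin's Axiom names the type
  \<open>'p\<close> whose subsets carry the partial orders. By \<open>martins_axiom_all_types\<close> below, for
  \<open>\<kappa>\<close> at most the continuum the instance \<open>'p = real\<close> implies all other instances.\<close>

definition martins_axiom :: "'p itself \<Rightarrow> 'k rel \<Rightarrow> bool"
  where "martins_axiom (_ :: 'p itself) \<kappa> \<longleftrightarrow>
    (\<forall>(P :: 'p set) r \<D>.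
       P \<noteq> {} \<and> partial_order_on P r \<and> ccc P r \<and> |\<D>| \<le>o \<kappa> \<and> (\<forall>D\<in>\<D>. dense_subset P r D)
       \<longrightarrow> (\<exists>G. poset_filter P r G \<and> (\<forall>D\<in>\<D>. G \<inter> D \<noteq> {})))"

text \<open>A Loewenheim-Skolem argument: every poset \<open>P\<close> has a subset \<open>Q\<close> that fits into
  \<open>'p\<close> and is closed under functions \<open>d\<close> and \<open>c\<close>, below chosen to extend conditions
  into the given dense sets and to witness compatibility.\<close>

lemma small_closed_subset:
  fixes P :: "'q set" and \<D> :: "'q set set" and c :: "'q \<Rightarrow> 'q \<Rightarrow> 'q"
    and d :: "'q set \<Rightarrow> 'q \<Rightarrow> 'q"
  assumes inf: "infinite (UNIV :: 'p set)" and \<D>: "|\<D>| \<le>o |UNIV :: 'p set|" and p0: "p0 \<in> P"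
    and c: "\<And>p q. p \<in> P \<Longrightarrow> q \<in> P \<Longrightarrow> c p q \<in> P"
    and d: "\<And>D p. D \<in> \<D> \<Longrightarrow> p \<in> P \<Longrightarrow> d D p \<in> P"
  obtains Q where "p0 \<in> Q" "Q \<subseteq> P" "|Q| \<le>o |UNIV :: 'p set|"
    "\<And>p q. p \<in> Q \<Longrightarrow> q \<in> Q \<Longrightarrow> c p q \<in> Q" "\<And>D p. D \<in> \<D> \<Longrightarrow> p \<in> Q \<Longrightarrow> d D p \<in> Q"
proof -
  define S where "S = (\<lambda>Q. Q \<union> case_prod d ` (\<D> \<times> Q) \<union> case_prod c ` (Q \<times> Q))"
  define F where "F n = (S ^^ n) {p0}" for n
  have F0: "F 0 = {p0}" and FS: "F (Suc n) = S (F n)" for n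
    by (simp_all add: F_def)
  have card: "|F n| \<le>o |UNIV :: 'p set|" for n
  proof (induction n)
    case 0
    then show ?case
      unfolding F0 by (rule card_of_singl_ordLeq) simp
  next
    case (Suc n)
    have "|\<D> \<times> F n| \<le>o |UNIV :: 'p set|" "|F n \<times> F n| \<le>o |UNIV :: 'p set|"
      using Suc \<D> inf by (simp_all add: card_of_Sigma_ordLeq_infinite)
    then have "|case_prod d ` (\<D> \<times> F n)| \<le>o |UNIV :: 'p set|"
      "|case_prod c ` (F n \<times> F n)| \<le>o |UNIV :: 'p set|"
      using card_of_image ordLeq_transitive by blast+
    then show ?case
      unfolding FS S_def using Suc inf by (metis Field_card_of card_of_Card_order card_of_Un_ordLeq_infinite_Field)
  qed
  have sub: "F n \<subseteq> P" for n
  proof (induction n)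
    case 0
    show ?case using p0 F0 by simp
  next
    case (Suc n)
    then have "p \<in> P" if "p \<in> F n" for p using that by blast
    then show ?case using Suc c d by (simp add: FS S_def image_subset_iff)
  qed
  have mono: "F m \<subseteq> F n" if "m \<le> n" for m n
    using that by (rule lift_Suc_mono_le[rotated]) (auto simp: FS S_def)
  show thesis
  proof (rule that[of "\<Union>n. F n"])
    show "p0 \<in> (\<Union>n. F n)" using F0 by blast
    show "(\<Union>n. F n) \<subseteq> P" using sub by blast
    show "|\<Union>n. F n| \<le>o |UNIV :: 'p set|"
    proof (rule card_of_UNION_ordLeq_infinite[OF inf])
      show "|UNIV :: nat set| \<le>o |UNIV :: 'p set|" using inf infinite_iff_card_of_nat by blast
    qed (use card in blast)
  next
    fix p q assume "p \<in> (\<Union>n. F n)" "q \<in> (\<Union>n. F n)"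
    then obtain m n where "p \<in> F m" "q \<in> F n" by blast
    then have "p \<in> F (max m n)" "q \<in> F (max m n)"
      using mono[of m "max m n"] mono[of n "max m n"] by auto
    then have "c p q \<in> F (Suc (max m n))" unfolding FS S_def by force
    then show "c p q \<in> (\<Union>n. F n)" by blast
  next
    fix D p assume "D \<in> \<D>" "p \<in> (\<Union>n. F n)"
    then obtain n where "p \<in> F n" by blast
    then have "d D p \<in> F (Suc n)" using \<open>D \<in> \<D>\<close> unfolding FS S_def by force
    then show "d D p \<in> (\<Union>n. F n)" by blast
  qed
qed

lemma martins_axiom_change_type:
  fixes \<kappa> :: "'k rel"
  assumes inf: "infinite (UNIV :: 'p set)" and \<kappa>: "\<kappa> \<le>o |UNIV :: 'p set|"
    and MA: "martins_axiom TYPE('p) \<kappa>"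
  shows "martins_axiom TYPE('q) \<kappa>"
  unfolding martins_axiom_def
proof (intro allI impI, elim conjE)
  fix P :: "'q set" and r \<D>
  assume ne: "P \<noteq> {}" and po: "partial_order_on P r" and ccc: "ccc P r"
    and \<D>: "|\<D>| \<le>o \<kappa>" and dense: "\<forall>D\<in>\<D>. dense_subset P r D"
  have refl: "(p, p) \<in> r" if "p \<in> P" for p
    using po that by (auto simp: partial_order_on_def preorder_on_def refl_on_def)
  have trans: "(p, s) \<in> r" if "(p, q) \<in> r" "(q, s) \<in> r" for p q s
    using po that unfolding partial_order_on_def preorder_on_def trans_def by blast
  have anti: "p = q" if "(p, q) \<in> r" "(q, p) \<in> r" for p q
    using po that unfolding partial_order_on_def antisym_def by blast
  obtain p0 where p0: "p0 \<in> P" using ne by blast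
  define c where "c p q = (if compatible_in P r p q
      then SOME s. s \<in> P \<and> (s, p) \<in> r \<and> (s, q) \<in> r else p0)" for p q
  define d where "d D p = (SOME e. e \<in> D \<and> (e, p) \<in> r)" for D p
  have c: "c p q \<in> P \<and> (c p q, p) \<in> r \<and> (c p q, q) \<in> r" if "compatible_in P r p q" for p q
    using that someI_ex[of "\<lambda>s. s \<in> P \<and> (s, p) \<in> r \<and> (s, q) \<in> r"]
    unfolding c_def compatible_in_def by auto
  have d: "d D p \<in> D \<and> (d D p, p) \<in> r" if "D \<in> \<D>" "p \<in> P" for D p
    using that dense someI_ex[of "\<lambda>e. e \<in> D \<and> (e, p) \<in> r"]
    unfolding d_def dense_subset_def by blast
  have cP: "c p q \<in> P" for p q
    using c p0 by (cases "compatible_in P r p q") (auto simp: c_def)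
  have dP: "d D p \<in> P" if "D \<in> \<D>" "p \<in> P" for D p
    using d[OF that] dense that unfolding dense_subset_def by blast
  have \<D>': "|\<D>| \<le>o |UNIV :: 'p set|" using \<D> \<kappa> ordLeq_transitive by blast
  obtain Q where Q: "p0 \<in> Q" "Q \<subseteq> P" "|Q| \<le>o |UNIV :: 'p set|"
    and Qc: "\<And>p q. p \<in> Q \<Longrightarrow> q \<in> Q \<Longrightarrow> c p q \<in> Q"
    and Qd: "\<And>D p. D \<in> \<D> \<Longrightarrow> p \<in> Q \<Longrightarrow> d D p \<in> Q"
    using small_closed_subset[OF inf \<D>' p0, of c d] cP dP by metis
  obtain f :: "'q \<Rightarrow> 'p" where f: "inj_on f Q"
    using Q(3) card_of_ordLeq[of Q "UNIV :: 'p set"] by blast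
  define r' where "r' = {(f p, f q) | p q. p \<in> Q \<and> q \<in> Q \<and> (p, q) \<in> r}"
  have r': "(f p, f q) \<in> r' \<longleftrightarrow> (p, q) \<in> r" if "p \<in> Q" "q \<in> Q" for p q
    using that f unfolding r'_def by (auto dest: inj_onD)
  define \<D>'' where "\<D>'' = (\<lambda>D. f ` (D \<inter> Q)) ` \<D>"
  have compat: "compatible_in (f ` Q) r' (f p) (f q)" 
    if "p \<in> Q" "q \<in> Q" "compatible_in P r p q" for p q
    using c[OF that(3)] Qc[OF that(1,2)] r' that unfolding compatible_in_def by blast
  have "f ` Q \<noteq> {}" using Q by blast
  moreover have "partial_order_on (f ` Q) r'"
    unfolding partial_order_on_def preorder_on_def
  proof (intro conjI)
    show "r' \<subseteq> f ` Q \<times> f ` Q" by (auto simp: r'_def)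
    show "refl_on (f ` Q) r'" using refl Q by (auto simp: refl_on_def r'_def)
    show "trans r'"
    proof (rule transI)
      fix x y z assume "(x, y) \<in> r'" "(y, z) \<in> r'"
      then show "(x, z) \<in> r'"
        unfolding r'_def using trans inj_onD[OF f] by blast
    qed
    show "antisym r'"
    proof (rule antisymI)
      fix x y assume "(x, y) \<in> r'" "(y, x) \<in> r'"
      then show "x = y"
        unfolding r'_def using anti inj_onD[OF f] by blast
    qed
  qed
  moreover have "ccc (f ` Q) r'"
    unfolding ccc_def
  proof (intro allI impI)
    fix C assume C: "C \<subseteq> f ` Q" "pairwise (\<lambda>p q. \<not> compatible_in (f ` Q) r' p q) C"
    obtain C0 where C0: "C0 \<subseteq> Q" "C = f ` C0" using C(1) subset_imageE by metis
    have "pairwise (\<lambda>p q. \<not> compatible_in P r p q) C0"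
      unfolding pairwise_def
    proof (intro ballI impI notI)
      fix p q assume pq: "p \<in> C0" "q \<in> C0" "p \<noteq> q" "compatible_in P r p q"
      then have "f p \<noteq> f q" using C0 f by (meson inj_on_def subsetD)
      then show False using C(2) compat pq C0 unfolding pairwise_def by blast
    qed
    then have "countable C0" using ccc C0 Q unfolding ccc_def by blast
    then show "countable C" using C0 by simp
  qed
  moreover have "|\<D>''| \<le>o \<kappa>"
    unfolding \<D>''_def using \<D> card_of_image ordLeq_transitive by blast
  moreover have "\<forall>D\<in>\<D>''. dense_subset (f ` Q) r' D"
  proof
    fix D' assume "D' \<in> \<D>''"
    then obtain D where D: "D \<in> \<D>" "D' = f ` (D \<inter> Q)" unfolding \<D>''_def by blast
    have "\<exists>e\<in>D'. (e, f p) \<in> r'" if "p \<in> Q" for p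
    proof
      have "p \<in> P" using that Q by blast
      then show "f (d D p) \<in> D'" using d Qd D that by blast
      show "(f (d D p), f p) \<in> r'" using r' Qd d D that \<open>p \<in> P\<close> by blast
    qed
    then show "dense_subset (f ` Q) r' D'" using D unfolding dense_subset_def by blast
  qed
  ultimately obtain G' where G': "poset_filter (f ` Q) r' G'" "\<forall>D\<in>\<D>''. G' \<inter> D \<noteq> {}"
    using MA[unfolded martins_axiom_def, rule_format, of "f ` Q" r' \<D>''] by metis
  define G where "G = {p \<in> P. \<exists>q\<in>Q. f q \<in> G' \<and> (q, p) \<in> r}"
  have "poset_filter P r G"
    unfolding poset_filter_def
  proof (intro conjI ballI impI)
    show "G \<subseteq> P" by (auto simp: G_def)
    show "G \<noteq> {}"
      using G'(1) Q refl unfolding poset_filter_def G_def by blast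
    show "q \<in> G" if "p \<in> G" "q \<in> P" "(p, q) \<in> r" for p q
      using that trans unfolding G_def by blast
    show "\<exists>s\<in>G. (s, p) \<in> r \<and> (s, q) \<in> r" if pq: "p \<in> G" "q \<in> G" for p q
    proof -
      obtain a b where ab: "a \<in> Q" "f a \<in> G'" "(a, p) \<in> r" "b \<in> Q" "f b \<in> G'" "(b, q) \<in> r"
        using pq unfolding G_def by blast
      then obtain t where t: "t \<in> G'" "(t, f a) \<in> r'" "(t, f b) \<in> r'"
        using G'(1) unfolding poset_filter_def by blast
      then obtain s where s: "s \<in> Q" "t = f s"
        using G'(1) unfolding poset_filter_def by blast
      then have "(s, a) \<in> r" "(s, b) \<in> r" using t r' ab by auto
      moreover have "s \<in> G" unfolding G_def using s t Q refl by blast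
      ultimately show ?thesis using ab trans by blast
    qed
  qed
  moreover have "\<forall>D\<in>\<D>. G \<inter> D \<noteq> {}"
  proof
    fix D assume "D \<in> \<D>"
    then obtain p where "p \<in> D \<inter> Q" "f p \<in> G'" using G'(2) unfolding \<D>''_def by blast
    then show "G \<inter> D \<noteq> {}" using Q refl unfolding G_def by blast
  qed
  ultimately show "\<exists>G. poset_filter P r G \<and> (\<forall>D\<in>\<D>. G \<inter> D \<noteq> {})" by blast
qed

corollary martins_axiom_all_types:
  fixes \<kappa> :: "'k rel" and X :: "real set"
  assumes "|X| =o \<kappa>" "martins_axiom TYPE(real) \<kappa>"
  shows "martins_axiom TYPE('q) \<kappa>"
proof (rule martins_axiom_change_type)
  show "\<kappa> \<le>o |UNIV :: real set|"
    using ordIso_ordLeq_trans[OF ordIso_symmetric[OF assms(1)] card_of_mono1[OF subset_UNIV]] .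
qed (use assms infinite_UNIV_char_0 in auto)

end

theory Submission
  imports Defs
begin

text \<open>Martin's Axiom is applied to the finite partial functions \<open>p\<close> on \<open>X\<close> that are barely
  alternating finite adjustments of \<open>A\<close> on their domains, ordered by extension. A domain extends by
  a point \<open>x\<close> because, on the finite set where the extended family is not yet a chain, the new set
  can copy a neighbour of \<open>x\<close>.

  For the countable chain condition, fix a countable \<open>D \<subseteq> X\<close> that meets every interval
  \<open>[x, y]\<close> with \<open>x < y\<close> in \<open>X\<close>. Separate the points of the domain of \<open>p\<close> by finitely many
  cuts located at points of \<open>D\<close>, and let \<open>N\<close> be a finite set outside of which \<open>p\<close> agrees
  with \<open>A\<close> and forms a chain together with the sets \<open>A d\<close> at these cuts. Only countably many
  configurations \<open>(N, cuts, traces of p on N)\<close> exist, and two conditions \<open>p\<close>, \<open>q\<close> of the same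
  configuration are compatible: on \<open>N\<close> the union copies the pattern of \<open>p\<close>; outside \<open>N\<close>
  membership can switch from true to false only between two points in the same position relative
  to the cuts, and each position has at most one point from \<open>p\<close> and one from \<open>q\<close>.\<close>

section \<open>Transport of alternation, a countable separating set, and the poset\<close>

lemma almost_subset_refl [simp]: "R \<subseteq>* R"
  by (simp add: almost_subset_def)

lemma barely_alternatingI:
  assumes "\<And>k x1 x2 x3 x4. \<lbrakk>x1 \<in> X; x2 \<in> X; x3 \<in> X; x4 \<in> X; x1 < x2; x2 < x3; x3 < x4;
    k \<in> B x1; k \<notin> B x2; k \<in> B x3; k \<notin> B x4\<rbrakk> \<Longrightarrow> False"
  shows "barely_alternating X B"
  using assms unfolding barely_alternating_def by blast

text \<open>Where membership of \<open>k\<close> changes between two points, their images under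
  \<open>f\<close> differ, so monotonicity makes them strictly ordered. An alternation of
  \<open>B'\<close> at \<open>k\<close> would therefore reappear in \<open>B\<close>. This serves
  the coordinates at which new sets copy old ones.\<close>

lemma barely_alternating_pullback:
  fixes F F' :: "real set"
  assumes "barely_alternating F B"
    and "x1 \<in> F'" "x2 \<in> F'" "x3 \<in> F'" "x4 \<in> F'" "x1 < x2" "x2 < x3" "x3 < x4"
    and "k \<in> B' x1" "k \<notin> B' x2" "k \<in> B' x3" "k \<notin> B' x4"
    and mono: "mono_on F' f" and f: "\<And>x. x \<in> F' \<Longrightarrow> f x \<in> F \<and> (k \<in> B (f x) \<longleftrightarrow> k \<in> B' x)"
  shows False
proof -
  have "f x < f y" if "x \<in> F'" "y \<in> F'" "x < y" "k \<in> B' x \<longleftrightarrow> k \<notin> B' y" for x y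
  proof -
    have "f x \<noteq> f y" using f that by metis
    moreover have "f x \<le> f y" using mono_onD[OF mono] that(1-3) by simp
    ultimately show ?thesis by simp
  qed
  then have "f x1 < f x2" "f x2 < f x3" "f x3 < f x4" using assms by auto
  then show False
    using assms(1) f assms(2-12) unfolding barely_alternating_def by blast
qed

lemma real_almost_chain_le:
  assumes "real_almost_chain X A" "x \<in> X" "y \<in> X" "x \<le> y"
  shows "A x \<subseteq>* A y"
  using assms by (cases "x = y") (auto simp: real_almost_chain_def)

text \<open>Points picked from rational intervals separate \<open>x\<close> and \<open>y\<close>
  when a third point of \<open>X\<close> lies between them. Otherwise \<open>x\<close> is the
  largest point of \<open>X\<close> below some rational, and there are only countably many such
  points.\<close>

lemma countable_separating_subset:
  fixes X :: "real set"
  obtains D where "countable D" "D \<subseteq> X"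
    "\<And>x y. \<lbrakk>x \<in> X; y \<in> X; x < y\<rbrakk> \<Longrightarrow> \<exists>d\<in>D. x \<le> d \<and> d \<le> y"
proof -
  define f where "f = (\<lambda>(a, b). SOME z. z \<in> X \<and> a < z \<and> z < b)"
  define g where "g r = (THE z. z \<in> X \<and> z < r \<and> (\<forall>w\<in>X. w < r \<longrightarrow> w \<le> z))" for r :: real
  \<comment> \<open>Intersecting with \<open>X\<close> discards stray values of \<open>f\<close> and
    \<open>g\<close> at arguments for which no suitable point exists.\<close>
  define D where "D = X \<inter> (f ` (\<rat> \<times> \<rat>) \<union> g ` \<rat>)"
  show thesis
  proof
    show "countable D" unfolding D_def by (intro countable_Int2 countable_Un countable_image
          countable_SIGMA countable_rat)
    show "D \<subseteq> X" by (simp add: D_def)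
    fix x y assume xy: "x \<in> X" "y \<in> X" "x < y"
    show "\<exists>d\<in>D. x \<le> d \<and> d \<le> y"
    proof (cases "\<exists>z\<in>X. x < z \<and> z < y")
      case True
      then obtain z where z: "z \<in> X" "x < z" "z < y" by blast
      obtain a b where ab: "a \<in> \<rat>" "b \<in> \<rat>" "x < a" "a < z" "z < b" "b < y"
        using Rats_dense_in_real z by metis
      then have "f (a, b) \<in> X \<and> a < f (a, b) \<and> f (a, b) < b"
        unfolding f_def using someI[of "\<lambda>z. z \<in> X \<and> a < z \<and> z < b" z] z by simp
      then have "f (a, b) \<in> D \<and> x \<le> f (a, b) \<and> f (a, b) \<le> y"
        using ab by (auto simp: D_def)
      then show ?thesis by blast
    next
      case False
      obtain r where r: "r \<in> \<rat>" "x < r" "r < y" using Rats_dense_in_real xy by metis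
      have "w \<le> x" if "w \<in> X" "w < r" for w
        using False that r by (meson leI less_trans)
      then have "g r = x"
        unfolding g_def using xy r by (intro the_equality) (auto intro: antisym)
      then have "x \<in> D" using r xy by (auto simp: D_def)
      then show ?thesis using xy by auto
    qed
  qed
qed

definition partial_adjustments :: "real set \<Rightarrow> (real \<Rightarrow> 'a set) \<Rightarrow> (real \<rightharpoonup> 'a set) set"
  where "partial_adjustments X A = {p. finite (dom p) \<and> dom p \<subseteq> X \<and>
    finite_adjustment (dom p) A (the \<circ> p) \<and> barely_alternating (dom p) (the \<circ> p)}"

definition extension_order :: "('a \<rightharpoonup> 'b) set \<Rightarrow> ('a \<rightharpoonup> 'b) rel"
  where "extension_order P = {(p, q). p \<in> P \<and> q \<in> P \<and> q \<subseteq>\<^sub>m p}"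

lemma partial_order_on_extension_order: "partial_order_on P (extension_order P)"
  unfolding partial_order_on_def preorder_on_def extension_order_def
  by (auto intro!: refl_onI transI antisymI intro: map_le_trans map_le_antisym)

subsection \<open>Density\<close>

lemma partial_adjustments_extend:
  assumes chain: "real_almost_chain X A" and p: "p \<in> partial_adjustments X A" and x: "x \<in> X"
  shows "\<exists>q\<in>partial_adjustments X A. x \<in> dom q \<and> p \<subseteq>\<^sub>m q"
proof (cases "x \<in> dom p")
  case True
  then show ?thesis using p by auto
next
  case False
  define F where "F = dom p"
  have F: "finite F" "F \<subseteq> X" and xF: "x \<notin> F"
    and adj: "\<And>u. u \<in> F \<Longrightarrow> A u =* the (p u)" and ba: "barely_alternating F (the \<circ> p)"
    using p False by (auto simp: partial_adjustments_def F_def finite_adjustment_def)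
  define F' where "F' = insert x F"
  \<comment> \<open>Outside this finite set, \<open>p\<close> equals \<open>A\<close> on
    \<open>F\<close>, and \<open>A\<close> is increasing on \<open>F'\<close>.\<close>
  define N where "N = (\<Union>u\<in>F. (A u - the (p u)) \<union> (the (p u) - A u)) \<union>
    (\<Union>u\<in>F'. \<Union>v\<in>F' \<inter> {u..}. A u - A v)"
  have "A u \<subseteq>* A v" if "u \<in> F'" "v \<in> F' \<inter> {u..}" for u v
    using that real_almost_chain_le[OF chain] x F by (auto simp: F'_def)
  then have N: "finite N"
    using F adj unfolding N_def almost_eq_def almost_subset_def
    by (intro finite_UnI finite_UN_I) (auto simp: F'_def)
  have NA: "k \<in> A u \<longleftrightarrow> k \<in> the (p u)" if "u \<in> F" "k \<notin> N" for u k
    using that unfolding N_def by blast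
  have Nmono: "k \<in> A v" if "u \<in> F'" "v \<in> F'" "u < v" "k \<notin> N" "k \<in> A u" for u v k
  proof (rule ccontr)
    assume "k \<notin> A v"
    then have "k \<in> A u - A v" "v \<in> F' \<inter> {u..}" using that by auto
    then have "k \<in> N" unfolding N_def using \<open>u \<in> F'\<close> by blast
    then show False using that by simp
  qed
  \<comment> \<open>The neighbour is the predecessor of \<open>x\<close> in \<open>F\<close>, or the
    minimum of \<open>F\<close> if nothing lies to the left. Sending \<open>x\<close> to
    \<open>y\<close> and fixing \<open>F\<close> is then monotone. If \<open>F\<close> is empty,
    \<open>y\<close> is arbitrary.\<close>
  have "\<exists>y. (F \<noteq> {} \<longrightarrow> y \<in> F) \<and> (\<forall>u\<in>F. u < x \<longrightarrow> u \<le> y) \<and> (\<forall>u\<in>F. x < u \<longrightarrow> y \<le> u)"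
  proof (cases "\<exists>u\<in>F. u < x")
    case True
    define L where "L = {u\<in>F. u < x}"
    have "finite L" "L \<noteq> {}" using F True by (auto simp: L_def)
    then have "Max L \<in> L" "\<And>u. u \<in> L \<Longrightarrow> u \<le> Max L" by auto
    then show ?thesis unfolding L_def by (intro exI[of _ "Max L"]) (auto simp: L_def)
  next
    case False
    then show ?thesis using F by (intro exI[of _ "Min F"]) auto
  qed
  then obtain y where y: "F \<noteq> {} \<Longrightarrow> y \<in> F" "\<And>u. u \<in> F \<Longrightarrow> u < x \<Longrightarrow> u \<le> y"
    "\<And>u. u \<in> F \<Longrightarrow> x < u \<Longrightarrow> y \<le> u" by blast
  define Bx where "Bx = (the (p y) \<inter> N) \<union> (A x - N)"
  define q where "q = p(x \<mapsto> Bx)"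
  have dom: "dom q = F'" by (simp add: q_def F'_def F_def)
  have q_out: "k \<in> the (q u) \<longleftrightarrow> k \<in> A u" if "u \<in> F'" "k \<notin> N" for u k
    using that NA by (auto simp: q_def F'_def Bx_def)
  have "A x =* Bx"
    using N finite_subset[of "A x - Bx" N] finite_subset[of "Bx - A x" N]
    by (auto simp: almost_eq_def almost_subset_def Bx_def)
  then have "finite_adjustment F' A (the \<circ> q)"
    using adj by (auto simp: finite_adjustment_def F'_def q_def)
  moreover have "barely_alternating F' (the \<circ> q)"
  proof (rule barely_alternatingI)
    fix k x1 x2 x3 x4
    assume X: "x1 \<in> F'" "x2 \<in> F'" "x3 \<in> F'" "x4 \<in> F'" "x1 < x2" "x2 < x3" "x3 < x4"
      and k: "k \<in> (the \<circ> q) x1" "k \<notin> (the \<circ> q) x2" "k \<in> (the \<circ> q) x3" "k \<notin> (the \<circ> q) x4"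
    show False
    proof (cases "k \<in> N")
      case True
      have "F \<noteq> {}" using X by (auto simp: F'_def)
      then have yF: "y \<in> F" using y by blast
      show False
      proof (rule barely_alternating_pullback[OF ba X k])
        show "mono_on F' (\<lambda>u. if u = x then y else u)"
        proof (rule mono_onI)
          fix u v assume "u \<in> F'" "v \<in> F'" "u \<le> v"
          then show "(if u = x then y else u) \<le> (if v = x then y else v)"
            using y(2)[of u] y(3)[of v] unfolding F'_def by auto
        qed
        show "(if u = x then y else u) \<in> F \<and>
          (k \<in> (the \<circ> p) (if u = x then y else u)) = (k \<in> (the \<circ> q) u)" if "u \<in> F'" for u
          using that yF True by (auto simp: F'_def q_def Bx_def)
      qed
    next
      case False
      have "k \<in> A x1" "k \<notin> A x2"
        using q_out[OF X(1) False] q_out[OF X(2) False] k by auto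
      then show False using Nmono[OF X(1,2,5) False] by blast
    qed
  qed
  moreover have "p \<subseteq>\<^sub>m q" using xF by (auto simp: map_le_def q_def F_def)
  ultimately show ?thesis
    using F x dom by (intro bexI[of _ q]) (auto simp: partial_adjustments_def F'_def)
qed

subsection \<open>The countable chain condition\<close>

text \<open>The flag \<open>b\<close> says on which side of the cut at \<open>d\<close> the point \<open>d\<close> itself lies.\<close>

definition cuts_above :: "(real \<times> bool) set \<Rightarrow> real \<Rightarrow> (real \<times> bool) set"
  where "cuts_above R x = {(d, b) \<in> R. x < d \<or> b \<and> x = d}"

lemma cuts_above_antimono: "x \<le> y \<Longrightarrow> cuts_above R y \<subseteq> cuts_above R x"
  by (auto simp: cuts_above_def)

text \<open>The set \<open>cuts_above R x\<close> encodes the position of \<open>x\<close> relative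
  to the cuts. \<open>T\<close> records the traces by position and forgets the actual points of the
  domain, which keeps the number of configurations countable.\<close>

definition has_configuration :: "(real \<Rightarrow> 'a set) \<Rightarrow> (real \<rightharpoonup> 'a set) \<Rightarrow>
    'a set \<times> (real \<times> bool) set \<times> ((real \<times> bool) set \<times> 'a set) set \<Rightarrow> bool"
  where "has_configuration A p = (\<lambda>(N, R, T).
    (\<forall>x\<in>dom p. the (p x) - N = A x - N) \<and> inj_on (cuts_above R) (dom p) \<and>
    (\<forall>x\<in>dom p. \<forall>(d, b)\<in>cuts_above R x. A x - N \<subseteq> A d) \<and>
    (\<forall>x\<in>dom p. \<forall>(d, b)\<in>R - cuts_above R x. A d - N \<subseteq> A x) \<and>
    T = (\<lambda>x. (cuts_above R x, the (p x) \<inter> N)) ` dom p)"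

lemma same_configuration_compatible:
  assumes p: "p \<in> partial_adjustments X A" "has_configuration A p (N, R, T)"
    and q: "q \<in> partial_adjustments X A" "has_configuration A q (N, R, T)"
  shows "compatible_in (partial_adjustments X A) (extension_order (partial_adjustments X A)) p q"
proof -
  let ?c = "cuts_above R"
  have out: "the (p x) - N = A x - N" if "x \<in> dom p" for x
    using p(2) that by (simp add: has_configuration_def)
  have outq: "the (q x) - N = A x - N" if "x \<in> dom q" for x
    using q(2) that by (simp add: has_configuration_def)
  have inj: "inj_on ?c (dom p)" "inj_on ?c (dom q)"
    using p(2) q(2) by (simp_all add: has_configuration_def)
  have T: "T = (\<lambda>x. (?c x, the (p x) \<inter> N)) ` dom p" "T = (\<lambda>x. (?c x, the (q x) \<inter> N)) ` dom q"
    using p(2) q(2) by (simp_all add: has_configuration_def)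
  \<comment> \<open>The shared \<open>T\<close> gives each point of \<open>dom q\<close> a partner
    in \<open>dom p\<close> with the same position and trace. By injectivity, a common point is its
    own partner, so \<open>p\<close> and \<open>q\<close> agree there.\<close>
  have "\<exists>y\<in>dom p. ?c y = ?c x \<and> the (p y) \<inter> N = the (q x) \<inter> N" if "x \<in> dom q" for x
  proof -
    have "(?c x, the (q x) \<inter> N) \<in> T" using T(2) that by blast
    then obtain y where "y \<in> dom p" "(?c x, the (q x) \<inter> N) = (?c y, the (p y) \<inter> N)"
      unfolding T(1) by (rule imageE) blast
    then show ?thesis by (intro bexI[of _ y]) simp_all
  qed
  then obtain f where f: "\<And>x. x \<in> dom q \<Longrightarrow> f x \<in> dom p \<and> ?c (f x) = ?c x \<and>
      the (p (f x)) \<inter> N = the (q x) \<inter> N" by metis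
  have agree: "p x = q x" if x: "x \<in> dom p" "x \<in> dom q" for x
  proof -
    have "f x = x" using f[OF x(2)] x(1) inj_onD[OF inj(1)] by blast
    then have "the (p x) \<inter> N = the (q x) \<inter> N" using f x by metis
    moreover have "the (p x) - N = the (q x) - N" using out outq x by simp
    ultimately have "the (p x) = the (q x)" by blast
    then show ?thesis using x by force
  qed
  define s where "s = q ++ p"
  have sp: "s x = p x" if "x \<in> dom p" for x using that by (auto simp: s_def map_add_dom_app_simps)
  have sq: "s x = q x" if "x \<in> dom q" for x
    using that agree by (cases "x \<in> dom p") (auto simp: s_def map_add_dom_app_simps)
  have dom: "dom s = dom p \<union> dom q" by (auto simp: s_def)
  have outs: "the (s x) - N = A x - N" if "x \<in> dom s" for x
    using that unfolding dom by (elim UnE) (simp_all only: out outq sp sq)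
  have below: "\<forall>x\<in>dom s. \<forall>(d, b)\<in>?c x. A x - N \<subseteq> A d"
    and above: "\<forall>x\<in>dom s. \<forall>(d, b)\<in>R - ?c x. A d - N \<subseteq> A x"
    using p(2) q(2) unfolding has_configuration_def prod.case dom ball_Un
    by - (elim conjE, intro conjI, assumption+)+
  \<comment> \<open>If a cut at \<open>d\<close> lay between \<open>u\<close> and \<open>v\<close>,
    then outside \<open>N\<close> membership would pass from \<open>A u\<close> through
    \<open>A d\<close> to \<open>A v\<close>.\<close>
  have same: "?c u = ?c v"
    if uv: "u \<in> dom s" "v \<in> dom s" "u < v" and k: "k \<notin> N" "k \<in> the (s u)" "k \<notin> the (s v)" for u v k
  proof (rule ccontr)
    assume "?c u \<noteq> ?c v"
    then obtain d b where d: "(d, b) \<in> ?c u" "(d, b) \<in> R - ?c v"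
      using cuts_above_antimono[of u v R] uv(3) by (auto simp: cuts_above_def)
    have "A u - N \<subseteq> A d" using below uv(1) d(1) by blast
    moreover have "A d - N \<subseteq> A v" using above uv(2) d(2) by blast
    ultimately show False using outs uv k by blast
  qed
  define g where "g x = (if x \<in> dom p then x else f x)" for x
  have g: "g x \<in> dom p" "?c (g x) = ?c x" "the (p (g x)) \<inter> N = the (s x) \<inter> N" if "x \<in> dom s" for x
    using that f sp sq unfolding g_def dom by (metis Un_iff)+
  have "barely_alternating (dom s) (the \<circ> s)"
  proof (rule barely_alternatingI)
    fix k x1 x2 x3 x4
    assume X: "x1 \<in> dom s" "x2 \<in> dom s" "x3 \<in> dom s" "x4 \<in> dom s" "x1 < x2" "x2 < x3" "x3 < x4"
      and k: "k \<in> (the \<circ> s) x1" "k \<notin> (the \<circ> s) x2" "k \<in> (the \<circ> s) x3" "k \<notin> (the \<circ> s) x4"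
    show False
    proof (cases "k \<in> N")
      case True
      have "barely_alternating (dom p) (the \<circ> p)"
        using p(1) by (simp add: partial_adjustments_def)
      then show False
      proof (rule barely_alternating_pullback[OF _ X k])
        show "mono_on (dom s) g"
        proof (rule mono_onI)
          fix u v assume uv: "u \<in> dom s" "v \<in> dom s" "u \<le> v"
          \<comment> \<open>A reversal of order would force the positions of \<open>g u\<close> and
            \<open>g v\<close> to coincide, and positions are injective on
            \<open>dom p\<close>.\<close>
          show "g u \<le> g v"
          proof (rule ccontr)
            assume gt: "\<not> g u \<le> g v"
            then have "?c (g u) \<subseteq> ?c (g v)" by (intro cuts_above_antimono) simp
            moreover have "?c (g v) \<subseteq> ?c (g u)"
              unfolding g(2)[OF uv(1)] g(2)[OF uv(2)] using uv(3) by (rule cuts_above_antimono)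
            ultimately have "?c (g u) = ?c (g v)" by (rule equalityI)
            then have "g u = g v"
              using g(1)[OF uv(1)] g(1)[OF uv(2)] by (rule inj_onD[OF inj(1)])
            then show False using gt by simp
          qed
        qed
        show "g u \<in> dom p \<and> (k \<in> (the \<circ> p) (g u)) = (k \<in> (the \<circ> s) u)" if "u \<in> dom s" for u
          using g(1,3)[OF that] True by auto
      qed
    next
      case False
      \<comment> \<open>Three distinct points then share one position, although two of them lie in
        the same domain.\<close>
      have "?c x1 = ?c x2" "?c x1 = ?c x4"
        using same[of x1 x2 k] same[of x1 x4 k] X k False by auto
      moreover have "x1 \<noteq> x2" "x1 \<noteq> x4" "x2 \<noteq> x4" using X(5-7) by auto
      ultimately show False
        using X(1,2,4) inj_onD[OF inj(1)] inj_onD[OF inj(2)] unfolding dom by (metis Un_iff)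
    qed
  qed
  moreover have "finite (dom s)" "dom s \<subseteq> X"
    using p(1) q(1) by (auto simp: partial_adjustments_def dom)
  moreover have "finite_adjustment (dom s) A (the \<circ> s)"
    using p(1) q(1) sp sq unfolding dom
    by (simp add: partial_adjustments_def finite_adjustment_def ball_Un)
  moreover have "p \<subseteq>\<^sub>m s" "q \<subseteq>\<^sub>m s"
    using sp sq by (auto simp: map_le_def)
  ultimately show ?thesis
    using p(1) q(1) unfolding compatible_in_def extension_order_def
    by (intro bexI[of _ s]) (auto simp: partial_adjustments_def)
qed

lemma configuration_exists:
  assumes chain: "real_almost_chain X A" and p: "p \<in> partial_adjustments X A"
    and D: "D \<subseteq> X" "\<And>x y. \<lbrakk>x \<in> X; y \<in> X; x < y\<rbrakk> \<Longrightarrow> \<exists>d\<in>D. x \<le> d \<and> d \<le> y"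
  obtains N R T where "N \<in> Fpow UNIV" "R \<in> Fpow (D \<times> UNIV)"
    "T \<in> Fpow (Fpow (D \<times> UNIV) \<times> Fpow UNIV)" "has_configuration A p (N, R, T)"
proof -
  define F where "F = dom p"
  have F: "finite F" "F \<subseteq> X" and adj: "\<And>u. u \<in> F \<Longrightarrow> A u =* the (p u)"
    using p by (auto simp: partial_adjustments_def F_def finite_adjustment_def)
  have "\<exists>d b. d \<in> D \<and> (x < d \<or> b \<and> x = d) \<and> \<not> (y < d \<or> b \<and> y = d)"
    if xy: "x \<in> F" "y \<in> F" "x < y" for x y
  proof -
    obtain d where "d \<in> D" "x \<le> d" "d \<le> y" using D(2)[of x y] xy F by blast
    \<comment> \<open>If \<open>d\<close> is \<open>x\<close>, the cut goes just above
      \<open>d\<close>; otherwise it goes just below, so that \<open>y\<close> stays above it even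
      if \<open>d\<close> is \<open>y\<close>.\<close>
    then show ?thesis using xy by (intro exI[of _ d] exI[of _ "x = d"]) auto
  qed
  then obtain d b where db: "\<And>x y. x \<in> F \<Longrightarrow> y \<in> F \<Longrightarrow> x < y \<Longrightarrow>
      d x y \<in> D \<and> (x < d x y \<or> b x y \<and> x = d x y) \<and> \<not> (y < d x y \<or> b x y \<and> y = d x y)"
    by metis
  define R where "R = (\<lambda>(x, y). (d x y, b x y)) ` {(x, y) \<in> F \<times> F. x < y}"
  have "finite {(x, y) \<in> F \<times> F. x < y}"
    using F by (auto intro: finite_subset[of _ "F \<times> F"])
  then have R: "finite R" "R \<subseteq> D \<times> UNIV"
    using db unfolding R_def by auto
  \<comment> \<open>Each piece is finite: \<open>p\<close> is a finite adjustment, and a cut above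
    \<open>x\<close> sits at a point at least \<open>x\<close>, any other cut at a point at most
    \<open>x\<close>, so the almost chain applies.\<close>
  define N where "N = (\<Union>x\<in>F. (A x - the (p x)) \<union> (the (p x) - A x) \<union>
    (\<Union>e\<in>cuts_above R x. A x - A (fst e)) \<union> (\<Union>e\<in>R - cuts_above R x. A (fst e) - A x))"
  define T where "T = (\<lambda>x. (cuts_above R x, the (p x) \<inter> N)) ` F"
  have cR: "cuts_above R x \<subseteq> R" for x by (auto simp: cuts_above_def)
  have "finite (A x - A (fst e))" if "x \<in> F" "e \<in> cuts_above R x" for x e
  proof -
    have "x \<in> X" "fst e \<in> X" "x \<le> fst e" using that F R D(1) by (auto simp: cuts_above_def)
    then show ?thesis using real_almost_chain_le[OF chain] by (simp add: almost_subset_def)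
  qed
  moreover have "finite (A (fst e) - A x)" if "x \<in> F" "e \<in> R - cuts_above R x" for x e
  proof -
    have "x \<in> X" "fst e \<in> X" "fst e \<le> x" using that F R D(1) by (auto simp: cuts_above_def)
    then show ?thesis using real_almost_chain_le[OF chain] by (simp add: almost_subset_def)
  qed
  ultimately have N: "finite N"
    using F R(1) adj finite_subset[OF cR R(1)] unfolding N_def almost_eq_def almost_subset_def
    by (intro finite_UnI finite_UN_I) auto
  have inj: "inj_on (cuts_above R) F"
  proof (rule linorder_inj_onI)
    fix x y assume xy: "x < y" "x \<in> F" "y \<in> F"
    then have "(d x y, b x y) \<in> R" by (auto simp: R_def)
    then have "(d x y, b x y) \<in> cuts_above R x" "(d x y, b x y) \<notin> cuts_above R y"
      using db[OF xy(2,3,1)] unfolding cuts_above_def by auto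
    then show "cuts_above R x \<noteq> cuts_above R y" by blast
  qed auto
  show thesis
  proof
    show "N \<in> Fpow UNIV" using N by (simp add: Fpow_def)
    show "R \<in> Fpow (D \<times> UNIV)" using R by (simp add: Fpow_def)
    have "cuts_above R x \<in> Fpow (D \<times> UNIV)" for x
      using cR[of x] R finite_subset[OF cR R(1)] by (auto simp: Fpow_def)
    then show "T \<in> Fpow (Fpow (D \<times> UNIV) \<times> Fpow UNIV)"
      using F N by (auto simp: T_def Fpow_def)
    show "has_configuration A p (N, R, T)"
      unfolding has_configuration_def prod.case F_def[symmetric]
    proof (intro conjI)
      show "\<forall>x\<in>F. the (p x) - N = A x - N" unfolding N_def by blast
      show "\<forall>x\<in>F. \<forall>(d, b)\<in>cuts_above R x. A x - N \<subseteq> A d" unfolding N_def by fastforce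
      show "\<forall>x\<in>F. \<forall>(d, b)\<in>R - cuts_above R x. A d - N \<subseteq> A x" unfolding N_def by fastforce
    qed (use inj T_def in auto)
  qed
qed

text \<open>Choosing a configuration for each member of an antichain is injective, and all
  configurations lie in a set built from finite subsets of countable sets.\<close>

lemma ccc_partial_adjustments:
  fixes A :: "real \<Rightarrow> 'a :: countable set"
  assumes chain: "real_almost_chain X A"
  shows "ccc (partial_adjustments X A) (extension_order (partial_adjustments X A))"
  unfolding ccc_def
proof (intro allI impI)
  let ?P = "partial_adjustments X A"
  fix C assume C: "C \<subseteq> ?P"
    "pairwise (\<lambda>p q. \<not> compatible_in ?P (extension_order ?P) p q) C"
  obtain D where D: "countable D" "D \<subseteq> X"
    "\<And>x y. \<lbrakk>x \<in> X; y \<in> X; x < y\<rbrakk> \<Longrightarrow> \<exists>d\<in>D. x \<le> d \<and> d \<le> y"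
    by (rule countable_separating_subset[of X]) blast
  define K where "K = (Fpow UNIV :: 'a set set) \<times> Fpow (D \<times> (UNIV :: bool set)) \<times>
    Fpow (Fpow (D \<times> (UNIV :: bool set)) \<times> (Fpow UNIV :: 'a set set))"
  have "countable K"
    unfolding K_def by (intro countable_SIGMA countable_Fpow D countableI_type)
  have "\<exists>c\<in>K. has_configuration A p c" if "p \<in> C" for p
    using configuration_exists[OF chain _ D(2,3), of p] C(1) that unfolding K_def by blast
  then obtain c where c: "\<And>p. p \<in> C \<Longrightarrow> c p \<in> K \<and> has_configuration A p (c p)" by metis
  have "inj_on c C"
  proof (rule inj_onI, rule ccontr)
    fix p q assume pq: "p \<in> C" "q \<in> C" "c p = c q" "p \<noteq> q"
    obtain N R T where "c p = (N, R, T)" by (cases "c p")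
    then have "compatible_in ?P (extension_order ?P) p q"
      using same_configuration_compatible c C(1) pq by (metis subsetD)
    then show False using C(2) pq unfolding pairwise_def by blast
  qed
  moreover have "countable (c ` C)"
    using countable_subset[OF _ \<open>countable K\<close>] c by blast
  ultimately show "countable C" using countable_image_inj_on by blast
qed

section \<open>The family read off from a generic filter\<close>

theorem theorem1p3:
  fixes \<kappa> :: "'k rel" and X :: "real set" and A :: "real \<Rightarrow> nat set"
  assumes "Card_order \<kappa>"
    and "martins_axiom TYPE(real) \<kappa>"
    and "|X| =o \<kappa>"
    and "real_almost_chain X A"
  shows "\<exists>B :: real \<Rightarrow> nat set. finite_adjustment X A B \<and> barely_alternating X B"
proof -
  define P where "P = partial_adjustments X A"
  define r where "r = extension_order P"
  define E where "E x = {p \<in> P. x \<in> dom p}" for x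
  \<comment> \<open>The conditions are partial functions, so the axiom is first moved from
    \<open>real\<close> to their type.\<close>
  have MA: "martins_axiom TYPE(real \<rightharpoonup> nat set) \<kappa>"
    using martins_axiom_all_types assms(2,3) by blast
  have "Map.empty \<in> P"
    by (simp add: P_def partial_adjustments_def finite_adjustment_def barely_alternating_def)
  moreover have "partial_order_on P r"
    unfolding r_def by (rule partial_order_on_extension_order)
  moreover have "ccc P r"
    unfolding r_def P_def using assms(4) by (rule ccc_partial_adjustments)
  moreover have "|E ` X| \<le>o \<kappa>"
    using card_of_image assms(3) ordLeq_ordIso_trans by blast
  moreover have "\<forall>D\<in>E ` X. dense_subset P r D"
    using partial_adjustments_extend[OF assms(4)]
    unfolding dense_subset_def E_def r_def extension_order_def P_def by blast
  ultimately obtain G where G: "poset_filter P r G" "\<forall>D\<in>E ` X. G \<inter> D \<noteq> {}"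
    using MA[unfolded martins_axiom_def, rule_format, of P r "E ` X"] by blast
  have "\<exists>p. p \<in> G \<and> x \<in> dom p" if "x \<in> X" for x
  proof -
    have "G \<inter> E x \<noteq> {}" using G(2) that by simp
    then show ?thesis unfolding E_def by blast
  qed
  then obtain h where h: "\<And>x. x \<in> X \<Longrightarrow> h x \<in> G \<and> x \<in> dom (h x)" by metis
  have GP: "G \<subseteq> P" using G(1) by (simp add: poset_filter_def)
  have common: "\<exists>s\<in>G. p \<subseteq>\<^sub>m s \<and> q \<subseteq>\<^sub>m s" if "p \<in> G" "q \<in> G" for p q
    using G(1) that unfolding poset_filter_def r_def extension_order_def by blast
  \<comment> \<open>The value does not change when \<open>h x\<close> is replaced by an extension,
    so a common extension in \<open>G\<close> of four conditions shows all four values of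
    \<open>B\<close> at once.\<close>
  define B where "B x = the (h x x)" for x
  have B: "B x = the (s x) \<and> x \<in> dom s" if "x \<in> X" "h x \<subseteq>\<^sub>m s" for x s
    using h[OF that(1)] that(2) by (auto simp: B_def map_le_def dom_def)
  have "A x =* B x" if "x \<in> X" for x
    using h[OF that] GP by (auto simp: P_def partial_adjustments_def finite_adjustment_def B_def)
  then have "finite_adjustment X A B" by (simp add: finite_adjustment_def)
  moreover have "barely_alternating X B"
  proof (rule barely_alternatingI)
    fix k x1 x2 x3 x4
    assume X: "x1 \<in> X" "x2 \<in> X" "x3 \<in> X" "x4 \<in> X" "x1 < x2" "x2 < x3" "x3 < x4"
      and k: "k \<in> B x1" "k \<notin> B x2" "k \<in> B x3" "k \<notin> B x4"
    obtain s t where st: "s \<in> G" "t \<in> G" "h x1 \<subseteq>\<^sub>m s" "h x2 \<subseteq>\<^sub>m s" "h x3 \<subseteq>\<^sub>m t" "h x4 \<subseteq>\<^sub>m t"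
      using common h X(1-4) by meson
    then obtain w where "w \<in> G" "s \<subseteq>\<^sub>m w" "t \<subseteq>\<^sub>m w" using common by blast
    then have w: "w \<in> G" "h x1 \<subseteq>\<^sub>m w" "h x2 \<subseteq>\<^sub>m w" "h x3 \<subseteq>\<^sub>m w" "h x4 \<subseteq>\<^sub>m w"
      using st map_le_trans by blast+
    then have "barely_alternating (dom w) (the \<circ> w)"
      using GP by (auto simp: P_def partial_adjustments_def)
    then show False
      using B[OF X(1) w(2)] B[OF X(2) w(3)] B[OF X(3) w(4)] B[OF X(4) w(5)] X(5-7) k
      unfolding barely_alternating_def comp_apply by blast
  qed
  ultimately show ?thesis by blast
qed

end
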